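(* The number of order-different additive ($1$-XOS) functions on $V=[n]$ (i.e., the number of order-equivalence classes of additive functions $f\colon 2^{[n]}\to\mathbb{R}$) is $2^{\Omega(n^2)}$.
   Context: A set function $f\colon 2^V\to\mathbb{R}$ is additive if $f(X)=\sum_{v\in X}f(\{v\})$ for all $X\subseteq V$ (values may be negative). Two set functions $f,g\colon 2^V\to\mathbb{R}$ are order-equivalent if for all $X,Y\subseteq V$, $f(X)\le f(Y)$ if and only if $g(X)\le g(Y)$; otherwise they are order-different. *)

theory Defs
  imports Complex_Main "HOL-Library.FuncSet" "HOL-Library.Landau_Symbols"
begin

text \<open>
  Set functions \<open>2\<^sup>V \<rightarrow> \<real>\<close> are functions on \<^term>\<open>Pow V\<close>, made extensional (\<open>undefined\<close> outside
  \<^term>\<open>Pow V\<close>), so that two of them are equal iff they agree on all subsets of \<open>V\<close>. The ground set \<open>V\<close> is meant to be finite: in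
  \<open>additive_on\<close>, a sum over an infinite \<open>X\<close> would be \<open>0\<close> by convention.
\<close>

definition additive_on :: "'a set \<Rightarrow> ('a set \<Rightarrow> real) \<Rightarrow> bool" where
  "additive_on V f \<longleftrightarrow> (\<forall>X\<subseteq>V. f X = (\<Sum>v\<in>X. f {v}))"

definition additive_functions :: "'a set \<Rightarrow> ('a set \<Rightarrow> real) set" where
  "additive_functions V = {f \<in> Pow V \<rightarrow>\<^sub>E UNIV. additive_on V f}"

definition order_equivalent_on :: "'a set \<Rightarrow> ('a set \<Rightarrow> real) \<Rightarrow> ('a set \<Rightarrow> real) \<Rightarrow> bool" where
  "order_equivalent_on V f g \<longleftrightarrow> (\<forall>X\<subseteq>V. \<forall>Y\<subseteq>V. f X \<le> f Y \<longleftrightarrow> g X \<le> g Y)"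

definition additive_order_rel :: "'a set \<Rightarrow> (('a set \<Rightarrow> real) \<times> ('a set \<Rightarrow> real)) set" where
  "additive_order_rel V =
     {(f, g). f \<in> additive_functions V \<and> g \<in> additive_functions V \<and> order_equivalent_on V f g}"

lemma equiv_additive_order_rel: "equiv (additive_functions V) (additive_order_rel V)"
  by (rule equivI)
     (auto simp: additive_order_rel_def order_equivalent_on_def intro!: refl_onI symI transI)

definition additive_order_classes :: "'a set \<Rightarrow> ('a set \<Rightarrow> real) set set" where
  "additive_order_classes V = additive_functions V // additive_order_rel V"

end

theory Submission
  imports Defs "HOL-Library.Nat_Bijection"
begin

text \<open>
  Split the ground set into \<open>B\<close> and its complement. Elements \<open>i \<in> B\<close> get weight \<open>2 ^ i\<close>, so distinct
  subsets of \<open>B\<close> have distinct values; each element \<open>j \<notin> B\<close> gets the value of some subset \<open>A j\<close> of \<open>B\<close>.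
  The tie between \<open>{j}\<close> and \<open>A j\<close> is visible in the order, so the order determines \<open>A\<close>. There are
  \<open>2 ^ (card B * card (V - B))\<close> choices of \<open>A\<close>, which is \<open>2 ^ \<lfloor>n\<^sup>2 / 4\<rfloor>\<close> for a balanced split.
\<close>

text \<open>Each class is the fibre over a single relation on \<open>Pow V\<close>, the order that
  its members induce, and a finite \<open>V\<close> admits only finitely many such
  relations.\<close>

lemma finite_additive_order_classes:
  assumes "finite V"
  shows "finite (additive_order_classes V)"
proof -
  define ord :: "('a set \<Rightarrow> real) \<Rightarrow> ('a set \<times> 'a set) set"
    where "ord f = {(X, Y). X \<subseteq> V \<and> Y \<subseteq> V \<and> f X \<le> f Y}" for f
  define cls where "cls r = {f \<in> additive_functions V. ord f = r}" for r
  have "additive_order_rel V `` {f} = cls (ord f)" if "f \<in> additive_functions V" for f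
    using that
    by (auto simp: cls_def ord_def additive_order_rel_def order_equivalent_on_def set_eq_iff)
  moreover have "ord f \<in> Pow (Pow V \<times> Pow V)" for f
    by (auto simp: ord_def)
  ultimately have "additive_order_classes V \<subseteq> cls ` Pow (Pow V \<times> Pow V)"
    unfolding additive_order_classes_def by (auto elim!: quotientE)
  then show ?thesis
    by (rule finite_subset) (use assms in simp)
qed

lemma restrict_sum_in_additive_functions:
  "(\<lambda>X\<in>Pow V. \<Sum>v\<in>X. w v) \<in> additive_functions V"
  by (auto simp: additive_functions_def additive_on_def intro!: sum.cong)

lemma additive_order_rel_eq_iff:
  assumes "(f, g) \<in> additive_order_rel V" "X \<subseteq> V" "Y \<subseteq> V"
  shows "f X = f Y \<longleftrightarrow> g X = g Y"
  using assms unfolding additive_order_rel_def order_equivalent_on_def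
  by (auto simp: order_eq_iff)

lemma card_additive_order_classes_ge:
  fixes V B :: "nat set"
  assumes "finite V" "B \<subseteq> V"
  shows "2 ^ (card B * card (V - B)) \<le> card (additive_order_classes V)"
proof -
  \<comment> \<open>\<open>set_encode\<close> sums \<open>2 ^ i\<close> over a finite set, so the
    weight of \<open>j\<close> outside \<open>B\<close> is exactly the total weight of
    \<open>A j\<close>.\<close>
  define w :: "(nat \<Rightarrow> nat set) \<Rightarrow> nat \<Rightarrow> real"
    where "w A v = (if v \<in> B then 2 ^ v else real (set_encode (A v)))" for A v
  define F where "F A = (\<lambda>X\<in>Pow V. \<Sum>v\<in>X. w A v)" for A
  define S where "S = (V - B) \<rightarrow>\<^sub>E Pow B"
  have finB: "finite B"
    using assms finite_subset by blast
  have F_in: "F A \<in> additive_functions V" for A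
    unfolding F_def by (rule restrict_sum_in_additive_functions)
  have F_B: "F A X = real (set_encode X)" if "X \<subseteq> B" for A X
  proof -
    have "F A X = (\<Sum>v\<in>X. w A v)"
      using that assms by (auto simp: F_def)
    also have "\<dots> = (\<Sum>v\<in>X. 2 ^ v)"
      using that by (intro sum.cong) (auto simp: w_def)
    finally show ?thesis
      by (simp add: set_encode_def)
  qed
  have F_single: "F A {j} = real (set_encode (A j))" if "j \<in> V - B" for A j
    using that by (simp add: F_def w_def)
  have "inj_on (\<lambda>A. additive_order_rel V `` {F A}) S"
  proof (rule inj_onI)
    fix A A'
    assume S: "A \<in> S" "A' \<in> S"
      and "additive_order_rel V `` {F A} = additive_order_rel V `` {F A'}"
    then have rel: "(F A, F A') \<in> additive_order_rel V"
      using eq_equiv_class[OF _ equiv_additive_order_rel F_in] by blast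
    show "A = A'"
    proof (rule PiE_ext)
      fix j assume j: "j \<in> V - B"
      have sub: "A j \<subseteq> B" "A' j \<subseteq> B"
        using S j unfolding S_def by (auto dest: PiE_mem)
      have "F A {j} = F A (A j)"
        by (simp add: F_B[OF sub(1)] F_single[OF j])
      \<comment> \<open>The tie carries over to \<open>F A'\<close>, where \<open>{j}\<close> has
        the value of \<open>A' j\<close> by construction; hence \<open>A j\<close> and
        \<open>A' j\<close> have the same code.\<close>
      then have "F A' {j} = F A' (A j)"
        using additive_order_rel_eq_iff[OF rel] j sub assms by auto
      then have "set_encode (A' j) = set_encode (A j)"
        by (simp add: F_B[OF sub(1)] F_single[OF j])
      \<comment> \<open>Binary codes are injective only on finite sets, hence the appeal to
        \<open>finB\<close>.\<close>
      then show "A j = A' j"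
        using set_encode_eq sub finB by (metis finite_subset)
    qed (use S in \<open>auto simp: S_def\<close>)
  qed
  moreover have "(\<lambda>A. additive_order_rel V `` {F A}) ` S \<subseteq> additive_order_classes V"
    unfolding additive_order_classes_def by (auto intro: quotientI F_in)
  ultimately have "card S \<le> card (additive_order_classes V)"
    using card_inj_on_le finite_additive_order_classes[OF assms(1)] by blast
  then show ?thesis
    using assms finB by (simp add: S_def card_PiE card_Pow power_mult)
qed

theorem theorem23:
  "\<exists>g :: nat \<Rightarrow> real. g \<in> \<Omega>(\<lambda>n. (real n)\<^sup>2) \<and>
     (\<forall>n. finite (additive_order_classes {1..n}) \<and>
          real (card (additive_order_classes {1..n})) = 2 powr g n)"
proof (intro exI conjI allI)
  let ?c = "\<lambda>n. card (additive_order_classes {1..n::nat})"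
  let ?e = "\<lambda>n. (n div 2) * (n - n div 2)"
  have ge: "2 ^ ?e n \<le> ?c n" for n
  proof -
    have "{1..n} - {1..n div 2} = {n div 2<..n}"
      by auto
    then show ?thesis
      using card_additive_order_classes_ge[of "{1..n}" "{1..n div 2}"] by auto
  qed
  \<comment> \<open>The witness for \<open>g\<close> is the binary logarithm of the class count;
    positivity makes \<open>2 powr g n\<close> return the count exactly.\<close>
  have pos: "?c n > 0" for n
    using ge[of n] by (meson less_le_trans zero_less_numeral zero_less_power)
  show "finite (additive_order_classes {1..n})" for n :: nat
    by (simp add: finite_additive_order_classes)
  show "real (?c n) = 2 powr log 2 (real (?c n))" for n
    using pos[of n] by simp
  have log_ge: "real (?e n) \<le> log 2 (real (?c n))" for n
  proof -
    have "2 ^ ?e n \<le> real (?c n)"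
      using ge[of n] by (metis of_nat_le_iff of_nat_numeral of_nat_power)
    then show ?thesis
      using pos[of n] by (simp add: le_log_iff powr_realpow del: of_nat_mult)
  qed
  \<comment> \<open>The constant 1/8 is the product of the bounds n/4 and n/2 for the two halves.
    The first fails at n = 1, where \<open>n div 2\<close> is 0.\<close>
  have quad: "1 / 8 * (real n)\<^sup>2 \<le> real (?e n)" if "n \<ge> 2" for n
  proof -
    have "n \<le> 4 * (n div 2)" "n \<le> 2 * (n - n div 2)"
      using that by linarith+
    then have "n * n \<le> 4 * (n div 2) * (2 * (n - n div 2))"
      by (rule mult_mono) auto
    then have "n\<^sup>2 \<le> 8 * ?e n"
      by (simp add: power2_eq_square algebra_simps)
    then have "real (n\<^sup>2) \<le> real (8 * ?e n)"
      by (rule of_nat_mono)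
    then show ?thesis
      by simp
  qed
  show "(\<lambda>n. log 2 (real (?c n))) \<in> \<Omega>(\<lambda>n. (real n)\<^sup>2)"
  proof (rule landau_omega.bigI)
    show "\<forall>\<^sub>F n in sequentially. 1 / 8 * norm ((real n)\<^sup>2) \<le> norm (log 2 (real (?c n)))"
      using eventually_ge_at_top[of 2]
    proof eventually_elim
      case (elim n)
      then show ?case
        using quad[of n] log_ge[of n] by simp
    qed
  qed simp
qed

end
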